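(* Let $n\ge 3$ be odd, $q=(n-1)/2$, and place $n$ equally spaced points on a circle, labelled cyclically by the elements $0,1,\dots,n-1$ of $\mathbb{Z}_n$. For a set $P$ of unordered pairs of elements of $\mathbb{Z}_n$, associate to each pair $\{x,y\}\in P$ the chord $[x,y]$ joining the points labelled $x$ and $y$. Consider the following properties of a set $C$ of chords: (a) no two chords of $C$ have the same length; (b) no two chords of $C$ are parallel; (c) no two chords of $C$ share a common endpoint; (d) the perpendicular bisector of no chord of $C$ passes through the point $0$; (e) the point $0$ is not an endpoint of any chord of $C$. If $S=\{\{x_i,y_i\}\}_{i=1}^q$ is a strong starter in $\mathbb{Z}_n$, then the set of $q$ chords $C=\{[x_i,y_i]\}_{i=1}^q$ satisfies (a)–(e). Conversely, if $C$ is any set of $q$ chords between these $n$ labelled points satisfying (a)–(e), then the set of pairs $\{\{x,y\} : [x,y]\in C\}$ is a strong starter in $\mathbb{Z}_n$.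
   Context: For an additive abelian group $G$ of odd order $n$, a starter in $G$ is a partition of $G\setminus\{0\}$ into $q=(n-1)/2$ pairs $\{\{s_i,t_i\}\}_{i=1}^q$ such that the elements $\pm(s_i-t_i)$, $i=1,\dots,q$, are exactly the non-zero elements of $G$. A starter is strong if the sums $s_i+t_i$, $i=1,\dots,q$, are non-zero and pairwise distinct. *)

theory Defs
  imports "HOL-Analysis.Analysis" "HOL-Algebra.Elementary_Groups"
begin

text \<open>Abelian groups are those of HOL-Algebra, hence written multiplicatively: the difference
  \<open>s - t\<close> is \<open>s \<otimes> inv t\<close> and zero is \<open>\<one>\<close>.  The ambient assumptions, that \<open>G\<close> is
  abelian and of odd order, are not part of the two definitions; they hold for
  \<open>integer_mod_group n\<close> with \<open>n\<close> odd.

  In \<open>starter\<close> a pair \<open>{s, t}\<close> contributes both \<open>s - t\<close> and \<open>t - s\<close>, because \<open>{s, t} = {t, s}\<close>.\<close>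

definition starter :: "('a, 'b) monoid_scheme \<Rightarrow> 'a set set \<Rightarrow> bool" where
  "starter G S \<longleftrightarrow>
     partition_on (carrier G - {\<one>\<^bsub>G\<^esub>}) S \<and>
     card S = (order G - 1) div 2 \<and>
     (\<forall>e\<in>S. card e = 2) \<and>
     {s \<otimes>\<^bsub>G\<^esub> inv\<^bsub>G\<^esub> t | s t. {s, t} \<in> S} = carrier G - {\<one>\<^bsub>G\<^esub>}"

definition strong_starter :: "('a, 'b) monoid_scheme \<Rightarrow> 'a set set \<Rightarrow> bool" where
  "strong_starter G S \<longleftrightarrow>
     starter G S \<and>
     (\<forall>s t. {s, t} \<in> S \<longrightarrow> s \<otimes>\<^bsub>G\<^esub> t \<noteq> \<one>\<^bsub>G\<^esub>) \<and>
     (\<forall>s t u v. {s, t} \<in> S \<longrightarrow> {u, v} \<in> S \<longrightarrow> {s, t} \<noteq> {u, v} \<longrightarrow>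
        s \<otimes>\<^bsub>G\<^esub> t \<noteq> u \<otimes>\<^bsub>G\<^esub> v)"

text \<open>The Euclidean plane is \<open>complex\<close>.  Centre, radius, position of the point \<open>0\<close> and
  orientation of the labelling are arbitrary.\<close>

definition equally_spaced_on_circle :: "nat \<Rightarrow> (int \<Rightarrow> complex) \<Rightarrow> bool" where
  "equally_spaced_on_circle n p \<longleftrightarrow>
     (\<exists>c r \<theta> \<sigma>. r > 0 \<and> \<sigma> \<in> {1, -1} \<and>
        (\<forall>k\<in>carrier (integer_mod_group n).
           p k = c + complex_of_real r * cis (\<theta> + \<sigma> * (2 * pi * real_of_int k / real n))))"

definition unordered_pairs :: "nat \<Rightarrow> int set set" where
  "unordered_pairs n = {e. e \<subseteq> carrier (integer_mod_group n) \<and> card e = 2}"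

definition chords_of_pairs :: "(int \<Rightarrow> complex) \<Rightarrow> int set set \<Rightarrow> complex set set" where
  "chords_of_pairs p P = {closed_segment (p x) (p y) | x y. {x, y} \<in> P}"

definition pairs_of_chords :: "nat \<Rightarrow> (int \<Rightarrow> complex) \<Rightarrow> complex set set \<Rightarrow> int set set" where
  "pairs_of_chords n p C =
     {{x, y} | x y. {x, y} \<in> unordered_pairs n \<and> closed_segment (p x) (p y) \<in> C}"

text \<open>A chord is a closed segment, as a point set.  It determines its set of endpoints
  (\<open>closed_segment_eq\<close>), so the properties below do not depend on how the segment is written.\<close>

definition no_two_same_length :: "complex set set \<Rightarrow> bool" where
  "no_two_same_length C \<longleftrightarrow>
     (\<forall>a b c d. closed_segment a b \<in> C \<longrightarrow> closed_segment c d \<in> C \<longrightarrow>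
        closed_segment a b \<noteq> closed_segment c d \<longrightarrow> dist a b \<noteq> dist c d)"

definition no_two_parallel :: "complex set set \<Rightarrow> bool" where
  "no_two_parallel C \<longleftrightarrow>
     (\<forall>K\<in>C. \<forall>L\<in>C. K \<noteq> L \<longrightarrow> \<not> affine_parallel (affine hull K) (affine hull L))"

definition no_two_share_endpoint :: "complex set set \<Rightarrow> bool" where
  "no_two_share_endpoint C \<longleftrightarrow>
     (\<forall>a b c d. closed_segment a b \<in> C \<longrightarrow> closed_segment c d \<in> C \<longrightarrow>
        closed_segment a b \<noteq> closed_segment c d \<longrightarrow> {a, b} \<inter> {c, d} = {})"

definition perpendicular_bisector :: "complex \<Rightarrow> complex \<Rightarrow> complex set" where
  "perpendicular_bisector a b = {z. (z - midpoint a b) \<bullet> (b - a) = 0}"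

definition no_bisector_through :: "complex \<Rightarrow> complex set set \<Rightarrow> bool" where
  "no_bisector_through z C \<longleftrightarrow>
     (\<forall>a b. closed_segment a b \<in> C \<longrightarrow> z \<notin> perpendicular_bisector a b)"

definition not_an_endpoint :: "complex \<Rightarrow> complex set set \<Rightarrow> bool" where
  "not_an_endpoint z C \<longleftrightarrow> (\<forall>a b. closed_segment a b \<in> C \<longrightarrow> z \<notin> {a, b})"

end

theory Submission
  imports Defs
begin

text \<open>A chord joining the points \<open>x\<close> and \<open>y\<close> has direction vector
  \<open>2 r sin (\<pi>(y - x)/n) \<i> cis (\<theta> + \<pi>(x + y)/n)\<close> (up to orientation).  Its modulus is governed by
  \<open>y - x\<close> up to sign modulo \<open>n\<close>, and its direction by \<open>x + y\<close> modulo \<open>n\<close>.  So equal length means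
  equal difference up to sign, parallel means equal sum, and the bisector passes through \<open>0\<close>
  precisely when the sum is zero.  It remains to count: \<open>(n - 1)/2\<close> pairs are disjoint and avoid
  zero iff they partition the non-zero elements, and their difference sets \<open>\<plusminus>(x - y)\<close>, which have
  two elements each because \<open>n\<close> is odd, are disjoint iff they cover the non-zero elements.\<close>

section \<open>Chords between equally spaced points\<close>

text \<open>Sum-to-product formulas. The angles are written with doubled summands so that half their
  difference and half their sum carry no fractions.\<close>

lemma cis_diff_cis:
  "cis (t + 2 * b) - cis (t + 2 * a) = complex_of_real (2 * sin (b - a)) * (\<i> * cis (t + (a + b)))"
proof (rule complex_eqI)
  have *: "(t + 2 * b + (t + 2 * a)) / 2 = t + (a + b)" "(t + 2 * b - (t + 2 * a)) / 2 = b - a"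
    "(t + 2 * a - (t + 2 * b)) / 2 = a - b"
    by (simp_all add: field_simps)
  have "sin (a - b) = - sin (b - a)"
    by (metis minus_diff_eq sin_minus)
  then show "Re (cis (t + 2 * b) - cis (t + 2 * a)) =
      Re (complex_of_real (2 * sin (b - a)) * (\<i> * cis (t + (a + b))))"
    unfolding cis.sel minus_complex.sel cos_diff_cos * by simp
  show "Im (cis (t + 2 * b) - cis (t + 2 * a)) =
      Im (complex_of_real (2 * sin (b - a)) * (\<i> * cis (t + (a + b))))"
    unfolding cis.sel minus_complex.sel sin_diff_sin * by simp
qed

lemma sin_pi_div_eq_0_iff:
  assumes "n > 0"
  shows "sin (pi / real n * real_of_int k) = 0 \<longleftrightarrow> int n dvd k"
proof -
  have "sin (pi / real n * real_of_int k) = 0 \<longleftrightarrow> (\<exists>i::int. real_of_int k = real_of_int (int n * i))"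
    unfolding sin_zero_iff_int2 using assms by (intro ex_cong1) (auto simp: field_simps)
  also have "\<dots> \<longleftrightarrow> int n dvd k"
    unfolding of_int_eq_iff dvd_def by simp
  finally show ?thesis .
qed

text \<open>The centre cancels in the difference, and the orientation sign goes into
  \<open>\<alpha>\<close>, which is plus or minus pi / n. The real factor is a signed length
  governed by the difference of the labels; the remaining unit vector is governed by their sum. The
  only property of \<open>\<alpha>\<close> passed on is its zero criterion.\<close>

lemma chord_vector:
  assumes "n > 0" "equally_spaced_on_circle n p"
  obtains d \<theta> \<alpha> :: real where "d > 0"
    and "\<And>k::int. sin (\<alpha> * real_of_int k) = 0 \<longleftrightarrow> int n dvd k"
    and "\<And>u v. u \<in> carrier (integer_mod_group n) \<Longrightarrow> v \<in> carrier (integer_mod_group n) \<Longrightarrow>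
      p v - p u = complex_of_real (d * sin (\<alpha> * real_of_int (v - u))) *
        (\<i> * cis (\<theta> + \<alpha> * real_of_int (u + v)))"
proof -
  obtain c r \<theta> \<sigma> where r: "r > 0" and \<sigma>: "\<sigma> \<in> {1, -1 :: real}"
    and p: "\<And>k. k \<in> carrier (integer_mod_group n) \<Longrightarrow>
      p k = c + complex_of_real r * cis (\<theta> + \<sigma> * (2 * pi * real_of_int k / real n))"
    using assms(2) unfolding equally_spaced_on_circle_def by blast
  define \<alpha> where "\<alpha> = \<sigma> * (pi / real n)"
  have "sin (\<alpha> * real_of_int k) = 0 \<longleftrightarrow> int n dvd k" for k
    using \<sigma> sin_pi_div_eq_0_iff[OF assms(1), of k] by (auto simp: \<alpha>_def)
  moreover have "p v - p u = complex_of_real (2 * r * sin (\<alpha> * real_of_int (v - u))) *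
        (\<i> * cis (\<theta> + \<alpha> * real_of_int (u + v)))"
    if "u \<in> carrier (integer_mod_group n)" "v \<in> carrier (integer_mod_group n)" for u v
  proof -
    have "\<sigma> * (2 * pi * real_of_int k / real n) = 2 * (\<alpha> * real_of_int k)" for k
      by (simp add: \<alpha>_def)
    then have "p v - p u = complex_of_real r *
        (cis (\<theta> + 2 * (\<alpha> * real_of_int v)) - cis (\<theta> + 2 * (\<alpha> * real_of_int u)))"
      using p that by (simp add: right_diff_distrib)
    also have "\<dots> = complex_of_real r * (complex_of_real (2 * sin (\<alpha> * real_of_int (v - u))) *
        (\<i> * cis (\<theta> + \<alpha> * real_of_int (u + v))))"
      unfolding cis_diff_cis by (simp add: right_diff_distrib distrib_left)
    finally show ?thesis
      by (simp add: mult_ac)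
  qed
  ultimately show thesis
    using that[of "2 * r" \<alpha> \<theta>] r by simp
qed

text \<open>Lengths are \<open>d\<close> times absolute values of sines, and these agree iff their
  squares do. The difference of two squared sines factors into sines of the difference and of the
  sum of the angles, one factor for each sign in the congruence.\<close>

lemma dist_points_eq_iff:
  assumes "n > 0" "equally_spaced_on_circle n p"
    and "x \<in> carrier (integer_mod_group n)" "y \<in> carrier (integer_mod_group n)"
    and "u \<in> carrier (integer_mod_group n)" "v \<in> carrier (integer_mod_group n)"
  shows "dist (p x) (p y) = dist (p u) (p v) \<longleftrightarrow>
    int n dvd (x - y) - (u - v) \<or> int n dvd (x - y) + (u - v)"
proof -
  obtain d \<theta> \<alpha> :: real where d: "d > 0"
    and dvd: "\<And>k::int. sin (\<alpha> * real_of_int k) = 0 \<longleftrightarrow> int n dvd k"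
    and vec: "\<And>u v. u \<in> carrier (integer_mod_group n) \<Longrightarrow> v \<in> carrier (integer_mod_group n) \<Longrightarrow>
      p v - p u = complex_of_real (d * sin (\<alpha> * real_of_int (v - u))) *
        (\<i> * cis (\<theta> + \<alpha> * real_of_int (u + v)))"
    by (rule chord_vector[OF assms(1,2)]) (rule that)
  have dist: "dist (p a) (p b) = d * \<bar>sin (\<alpha> * real_of_int (a - b))\<bar>"
    if "a \<in> carrier (integer_mod_group n)" "b \<in> carrier (integer_mod_group n)" for a b
    unfolding dist_norm vec[OF that(2,1)] using d by (simp add: norm_mult abs_mult)
  have sq: "(sin a)\<^sup>2 - (sin b)\<^sup>2 = sin (a - b) * sin (a + b)" for a b :: real
  proof -
    have "sin (a - b) * sin (a + b) = (sin a)\<^sup>2 * (cos b)\<^sup>2 - (cos a)\<^sup>2 * (sin b)\<^sup>2"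
      by (simp add: sin_add sin_diff power2_eq_square algebra_simps)
    then show ?thesis
      by (simp add: cos_squared_eq algebra_simps)
  qed
  have "dist (p x) (p y) = dist (p u) (p v) \<longleftrightarrow>
      (sin (\<alpha> * real_of_int (x - y)))\<^sup>2 - (sin (\<alpha> * real_of_int (u - v)))\<^sup>2 = 0"
    using d by (simp add: dist assms power2_eq_iff abs_eq_iff)
  also have "\<dots> \<longleftrightarrow> sin (\<alpha> * real_of_int ((x - y) - (u - v))) = 0 \<or>
      sin (\<alpha> * real_of_int ((x - y) + (u - v))) = 0"
    unfolding sq by (simp add: right_diff_distrib distrib_left)
  finally show ?thesis
    unfolding dvd .
qed

text \<open>Labels are the representatives 0, ..., n - 1, so congruent labels coincide.\<close>

lemma dvd_diff_carrier_imp_eq: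
  assumes "n > 0" "x \<in> carrier (integer_mod_group n)" "y \<in> carrier (integer_mod_group n)"
    and "int n dvd x - y"
  shows "x = y"
  using assms by (auto simp: carrier_integer_mod_group mod_eq_dvd_iff[symmetric])

lemma inj_on_equally_spaced:
  assumes "n > 0" "equally_spaced_on_circle n p"
  shows "inj_on p (carrier (integer_mod_group n))"
proof (rule inj_onI)
  fix x y
  assume "x \<in> carrier (integer_mod_group n)" "y \<in> carrier (integer_mod_group n)" "p x = p y"
  then show "x = y"
    \<comment> \<open>Comparison with the degenerate chord from \<open>x\<close> to
      \<open>x\<close>, of length zero, leaves \<open>int n dvd x - y\<close>.\<close>
    using dist_points_eq_iff[OF assms, of x y x x] dvd_diff_carrier_imp_eq[OF assms(1)] by simp
qed

section \<open>Parallel chords\<close>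

text \<open>\<open>affine_parallel\<close> means being a translate. This reduces it to proportional
  direction vectors.\<close>

lemma affine_parallel_hull_iff:
  assumes "c \<noteq> d"
  shows "affine_parallel (affine hull {a, b}) (affine hull {c, d}) \<longleftrightarrow>
    (\<exists>t. t \<noteq> 0 \<and> d - c = t *\<^sub>R (b - a))"
proof
  assume "affine_parallel (affine hull {a, b}) (affine hull {c, d})"
  then obtain w where w: "affine hull {c, d} = (\<lambda>x. w + x) ` (affine hull {a, b})"
    unfolding affine_parallel_def by blast
  have "c \<in> affine hull {c, d}" "d \<in> affine hull {c, d}"
    by (simp_all add: hull_inc)
  then obtain s t where "c = w + (a + s *\<^sub>R (b - a))" "d = w + (a + t *\<^sub>R (b - a))"
    unfolding w unfolding affine_hull_2_alt by auto
  \<comment> \<open>Both points come from the first line by the same translation \<open>w\<close>,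
    which cancels in their difference.\<close>
  then have "d - c = (t - s) *\<^sub>R (b - a)"
    by (simp add: scaleR_diff_left)
  then show "\<exists>t. t \<noteq> 0 \<and> d - c = t *\<^sub>R (b - a)"
    using assms by (intro exI[of _ "t - s"]) auto
next
  assume "\<exists>t. t \<noteq> 0 \<and> d - c = t *\<^sub>R (b - a)"
  then obtain t where t: "t \<noteq> 0" "d - c = t *\<^sub>R (b - a)"
    by blast
  \<comment> \<open>The witness for the translation is \<open>c - a\<close>; the two
    parametrisations differ by the factor \<open>t\<close>.\<close>
  have "range (\<lambda>u. c + u *\<^sub>R (d - c)) = range (\<lambda>u. (c - a) + (a + u *\<^sub>R (b - a)))" (is "?L = ?R")
  proof
    show "?L \<subseteq> ?R"
      by (auto simp: t)
    have "(c - a) + (a + u *\<^sub>R (b - a)) = c + (u / t) *\<^sub>R (d - c)" for u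
      using t by simp
    then show "?R \<subseteq> ?L"
      by blast
  qed
  then show "affine_parallel (affine hull {a, b}) (affine hull {c, d})"
    unfolding affine_parallel_def affine_hull_2_alt image_image by blast
qed

text \<open>Up to nonzero real factors the second direction is the first one rotated by
  \<open>\<delta>\<close>, so the chords are parallel iff \<open>cis \<delta>\<close> is real. This
  happens iff \<open>n\<close> divides the difference of the label sums.\<close>

lemma affine_parallel_chords_iff:
  assumes "n > 0" "equally_spaced_on_circle n p"
    and "x \<in> carrier (integer_mod_group n)" "y \<in> carrier (integer_mod_group n)" "x \<noteq> y"
    and "u \<in> carrier (integer_mod_group n)" "v \<in> carrier (integer_mod_group n)" "u \<noteq> v"
  shows "affine_parallel (affine hull (closed_segment (p x) (p y)))
      (affine hull (closed_segment (p u) (p v))) \<longleftrightarrow> int n dvd (x + y) - (u + v)"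
proof -
  obtain d \<theta> \<alpha> :: real where d: "d > 0"
    and dvd: "\<And>k::int. sin (\<alpha> * real_of_int k) = 0 \<longleftrightarrow> int n dvd k"
    and vec: "\<And>u v. u \<in> carrier (integer_mod_group n) \<Longrightarrow> v \<in> carrier (integer_mod_group n) \<Longrightarrow>
      p v - p u = complex_of_real (d * sin (\<alpha> * real_of_int (v - u))) *
        (\<i> * cis (\<theta> + \<alpha> * real_of_int (u + v)))"
    by (rule chord_vector[OF assms(1,2)]) (rule that)
  define A where "A = d * sin (\<alpha> * real_of_int (y - x))"
  define B where "B = d * sin (\<alpha> * real_of_int (v - u))"
  define \<delta> where "\<delta> = \<alpha> * real_of_int ((u + v) - (x + y))"
  define e where "e = \<i> * cis (\<theta> + \<alpha> * real_of_int (x + y))"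
  \<comment> \<open>The signed lengths vanish only if the two labels of a chord are congruent, hence
    equal.\<close>
  have nz: "A \<noteq> 0" "B \<noteq> 0" "e \<noteq> 0"
    using dvd_diff_carrier_imp_eq[OF assms(1)] assms d unfolding A_def B_def e_def
    by (auto simp: dvd simp del: of_int_diff)
  have xy: "p y - p x = complex_of_real A * e"
    unfolding A_def e_def by (rule vec) (use assms in auto)
  have "p v - p u = complex_of_real B * (\<i> * cis (\<theta> + \<alpha> * real_of_int (u + v)))"
    unfolding B_def by (rule vec) (use assms in auto)
  also have "\<theta> + \<alpha> * real_of_int (u + v) = (\<theta> + \<alpha> * real_of_int (x + y)) + \<delta>"
    by (simp add: \<delta>_def algebra_simps)
  finally have uv: "p v - p u = complex_of_real B * (e * cis \<delta>)"
    by (simp add: e_def cis_mult[symmetric] mult.assoc)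
  have "affine hull (closed_segment a b) = affine hull {a, b}" for a b :: complex
    by (simp add: segment_convex_hull)
  moreover have "p u \<noteq> p v"
    using inj_on_equally_spaced[OF assms(1,2)] assms by (auto dest: inj_onD)
  ultimately have "affine_parallel (affine hull (closed_segment (p x) (p y)))
      (affine hull (closed_segment (p u) (p v))) \<longleftrightarrow>
      (\<exists>t. t \<noteq> 0 \<and> p v - p u = t *\<^sub>R (p y - p x))"
    by (simp add: affine_parallel_hull_iff)
  also have "\<dots> \<longleftrightarrow> (\<exists>t. t \<noteq> 0 \<and> complex_of_real B * cis \<delta> = complex_of_real (t * A))"
    unfolding xy uv using nz by (auto simp: scaleR_conv_of_real)
  also have "\<dots> \<longleftrightarrow> sin \<delta> = 0"
  proof
    assume "\<exists>t. t \<noteq> 0 \<and> complex_of_real B * cis \<delta> = complex_of_real (t * A)"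
    \<comment> \<open>The imaginary part is \<open>B * sin \<delta>\<close> with \<open>B\<close>
      nonzero.\<close>
    then have "Im (complex_of_real B * cis \<delta>) = 0"
      by (metis Im_complex_of_real)
    then show "sin \<delta> = 0"
      using nz by simp
  next
    assume s: "sin \<delta> = 0"
    then have c: "cos \<delta> \<noteq> 0"
      using sin_cos_squared_add[of \<delta>] by auto
    \<comment> \<open>Here \<open>cis \<delta>\<close> is the real number
      \<open>cos \<delta>\<close>. Dividing by \<open>A\<close> gives the scaling factor, nonzero
      because \<open>B\<close> and \<open>cos \<delta>\<close> are.\<close>
    have "complex_of_real B * cis \<delta> = complex_of_real ((B * cos \<delta> / A) * A)"
      using s nz by (simp add: complex_eq_iff)
    then show "\<exists>t. t \<noteq> 0 \<and> complex_of_real B * cis \<delta> = complex_of_real (t * A)"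
      using nz c by (intro exI[of _ "B * cos \<delta> / A"]) auto
  qed
  also have "\<dots> \<longleftrightarrow> int n dvd (x + y) - (u + v)"
    unfolding \<delta>_def dvd by (metis dvd_minus_iff minus_diff_eq)
  finally show ?thesis .
qed

section \<open>Perpendicular bisectors\<close>

text \<open>Twice the inner product that defines the bisector expands to the difference of the
  squared distances to \<open>a\<close> and \<open>b\<close>.\<close>

lemma mem_perpendicular_bisector_iff:
  "z \<in> perpendicular_bisector a b \<longleftrightarrow> dist z a = dist z b"
proof -
  have "2 * ((z - midpoint a b) \<bullet> (b - a)) = (dist z a)\<^sup>2 - (dist z b)\<^sup>2"
    unfolding dist_norm power2_norm_eq_inner midpoint_def
    by (simp add: inner_diff_left inner_diff_right inner_add_left inner_commute algebra_simps)
  then have "(z - midpoint a b) \<bullet> (b - a) = 0 \<longleftrightarrow> (dist z a)\<^sup>2 = (dist z b)\<^sup>2"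
    by linarith
  then show ?thesis
    unfolding perpendicular_bisector_def by (simp add: power2_eq_iff_nonneg)
qed

text \<open>Equidistance of \<open>p 0\<close> from both endpoints is the length criterion for the
  differences \<open>- x\<close> and \<open>- y\<close>. One sign would make \<open>x\<close> and
  \<open>y\<close> congruent, which is excluded; the other sign gives the sum.\<close>

lemma zero_mem_bisector_iff:
  assumes "n > 0" "equally_spaced_on_circle n p"
    and "x \<in> carrier (integer_mod_group n)" "y \<in> carrier (integer_mod_group n)" "x \<noteq> y"
  shows "p 0 \<in> perpendicular_bisector (p x) (p y) \<longleftrightarrow> int n dvd x + y"
proof -
  have "int n dvd - x - - y \<longleftrightarrow> int n dvd x - y" "int n dvd - x - y \<longleftrightarrow> int n dvd x + y"
    using dvd_minus_iff[of "int n" "x - y"] dvd_minus_iff[of "int n" "x + y"] by simp_all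
  moreover have "\<not> int n dvd x - y"
    using dvd_diff_carrier_imp_eq assms by blast
  ultimately show ?thesis
    using dist_points_eq_iff[OF assms(1,2), of 0 x 0 y] assms
    by (simp add: mem_perpendicular_bisector_iff)
qed

section \<open>Passing between sets of pairs and sets of chords\<close>

lemma unordered_pairsD:
  assumes "P \<subseteq> unordered_pairs n" "{x, y} \<in> P"
  shows "x \<in> carrier (integer_mod_group n)" "y \<in> carrier (integer_mod_group n)" "x \<noteq> y"
  using assms by (auto simp: unordered_pairs_def card_2_iff doubleton_eq_iff)

lemma unordered_pairs_doubleton:
  assumes "P \<subseteq> unordered_pairs n" "e \<in> P"
  obtains x y where "e = {x, y}"
  using assms unfolding unordered_pairs_def card_2_iff by blast

text \<open>A segment determines its endpoints up to order, and \<open>{x, y}\<close> is symmetric,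
  so the labels can be chosen in the order in which the segment is written.\<close>

lemma closed_segment_in_chords_iff:
  "closed_segment a b \<in> chords_of_pairs p P \<longleftrightarrow> (\<exists>x y. a = p x \<and> b = p y \<and> {x, y} \<in> P)"
proof
  assume "closed_segment a b \<in> chords_of_pairs p P"
  then obtain x y where "{a, b} = {p x, p y}" "{x, y} \<in> P"
    unfolding chords_of_pairs_def by (auto simp: closed_segment_eq)
  then show "\<exists>x y. a = p x \<and> b = p y \<and> {x, y} \<in> P"
    unfolding doubleton_eq_iff by (metis insert_commute)
qed (auto simp: chords_of_pairs_def)

text \<open>Moves the quantifiers in the chord properties from endpoints in the plane to
  labels.\<close>

lemma all_two_chords_iff:
  "(\<forall>a b c d. closed_segment a b \<in> chords_of_pairs p P \<longrightarrow>
      closed_segment c d \<in> chords_of_pairs p P \<longrightarrow> Q a b c d) \<longleftrightarrow>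
    (\<forall>x y u v. {x, y} \<in> P \<longrightarrow> {u, v} \<in> P \<longrightarrow> Q (p x) (p y) (p u) (p v))"
  (is "?L \<longleftrightarrow> ?R")
proof
  have "closed_segment (p x) (p y) \<in> chords_of_pairs p P" if "{x, y} \<in> P" for x y
    using that unfolding chords_of_pairs_def by blast
  then show "?L \<Longrightarrow> ?R"
    by simp
  show "?R \<Longrightarrow> ?L"
    unfolding closed_segment_in_chords_iff by auto
qed

lemma closed_segment_eq_chord_iff:
  assumes "n > 0" "equally_spaced_on_circle n p"
    and "P \<subseteq> unordered_pairs n" "{x, y} \<in> P" "{u, v} \<in> P"
  shows "closed_segment (p x) (p y) = closed_segment (p u) (p v) \<longleftrightarrow> {x, y} = {u, v}"
proof -
  have "p ` {x, y} = p ` {u, v} \<longleftrightarrow> {x, y} = {u, v}"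
    by (rule inj_on_image_eq_iff[OF inj_on_equally_spaced[OF assms(1,2)]])
      (use unordered_pairsD[OF assms(3)] assms(4,5) in blast)+
  then show ?thesis
    by (simp add: closed_segment_eq)
qed

lemma card_chords_of_pairs:
  assumes "n > 0" "equally_spaced_on_circle n p" "P \<subseteq> unordered_pairs n"
  shows "card (chords_of_pairs p P) = card P"
proof -
  \<comment> \<open>Convex hulls express a chord as a function of the unordered pair itself, so the
    set of chords becomes an image and injectivity yields its cardinality.\<close>
  let ?f = "\<lambda>e. convex hull (p ` e)"
  have doubleton: "\<exists>x y. e = {x, y}" if "e \<in> P" for e
    using unordered_pairs_doubleton[OF assms(3) that] by metis
  have f: "?f {x, y} = closed_segment (p x) (p y)" for x y
    by (simp add: segment_convex_hull)
  have "chords_of_pairs p P = ?f ` P"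
  proof
    show "chords_of_pairs p P \<subseteq> ?f ` P"
      unfolding chords_of_pairs_def f[symmetric] by blast
    show "?f ` P \<subseteq> chords_of_pairs p P"
      unfolding chords_of_pairs_def f[symmetric] using doubleton by blast
  qed
  moreover have "inj_on ?f P"
  proof (rule inj_onI)
    fix e e' assume "e \<in> P" "e' \<in> P" "?f e = ?f e'"
    then show "e = e'"
      using doubleton closed_segment_eq_chord_iff[OF assms] f by metis
  qed
  ultimately show ?thesis
    by (simp add: card_image)
qed

text \<open>With this, criteria proved for chords of a set of pairs apply to an arbitrary set of
  chords between the labelled points.\<close>

lemma chords_of_pairs_of_chords:
  assumes "C \<subseteq> chords_of_pairs p (unordered_pairs n)"
  shows "chords_of_pairs p (pairs_of_chords n p C) = C"
proof
  show "chords_of_pairs p (pairs_of_chords n p C) \<subseteq> C"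
    unfolding chords_of_pairs_def pairs_of_chords_def
    by (auto simp: doubleton_eq_iff closed_segment_commute)
  show "C \<subseteq> chords_of_pairs p (pairs_of_chords n p C)"
  proof
    fix K assume "K \<in> C"
    then obtain x y where "K = closed_segment (p x) (p y)" "{x, y} \<in> unordered_pairs n"
      using assms unfolding chords_of_pairs_def by blast
    moreover from this \<open>K \<in> C\<close> have "{x, y} \<in> pairs_of_chords n p C"
      unfolding pairs_of_chords_def by blast
    ultimately show "K \<in> chords_of_pairs p (pairs_of_chords n p C)"
      unfolding chords_of_pairs_def by blast
  qed
qed

section \<open>The five chord properties as conditions on pairs modulo n\<close>

text \<open>One congruence replaces the two of the length criterion: both orders of \<open>u\<close>
  and \<open>v\<close> are among the instances, and swapping them changes the sign.\<close>

lemma no_two_same_length_iff: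
  assumes "n > 0" "equally_spaced_on_circle n p" "P \<subseteq> unordered_pairs n"
  shows "no_two_same_length (chords_of_pairs p P) \<longleftrightarrow>
    (\<forall>x y u v. {x, y} \<in> P \<longrightarrow> {u, v} \<in> P \<longrightarrow> {x, y} \<noteq> {u, v} \<longrightarrow>
      \<not> int n dvd (x - y) - (u - v))" (is "_ \<longleftrightarrow> ?R")
proof -
  have dist: "dist (p x) (p y) = dist (p u) (p v) \<longleftrightarrow>
      int n dvd (x - y) - (u - v) \<or> int n dvd (x - y) - (v - u)"
    if "{x, y} \<in> P" "{u, v} \<in> P" for x y u v
    using dist_points_eq_iff[OF assms(1,2)] unordered_pairsD[OF assms(3)] that
    by (simp add: algebra_simps)
  have "no_two_same_length (chords_of_pairs p P) \<longleftrightarrow>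
    (\<forall>x y u v. {x, y} \<in> P \<longrightarrow> {u, v} \<in> P \<longrightarrow> {x, y} \<noteq> {u, v} \<longrightarrow>
      dist (p x) (p y) \<noteq> dist (p u) (p v))"
    unfolding no_two_same_length_def all_two_chords_iff
    using closed_segment_eq_chord_iff[OF assms] by (metis (no_types, lifting))
  also have "\<dots> \<longleftrightarrow> ?R"
  proof (intro iffI allI impI)
    fix x y u v
    assume *: ?R and xyuv: "{x, y} \<in> P" "{u, v} \<in> P" "{x, y} \<noteq> {u, v}"
    \<comment> \<open>The second congruence is the instance with \<open>u\<close> and
      \<open>v\<close> exchanged.\<close>
    have "\<not> int n dvd (x - y) - (u - v)" "\<not> int n dvd (x - y) - (v - u)"
      using *[rule_format, of x y u v] *[rule_format, of x y v u] xyuv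
      by (simp_all add: insert_commute)
    then show "dist (p x) (p y) \<noteq> dist (p u) (p v)"
      using dist xyuv by simp
  qed (use dist in simp)
  finally show ?thesis .
qed

lemma no_two_parallel_iff:
  assumes "n > 0" "equally_spaced_on_circle n p" "P \<subseteq> unordered_pairs n"
  shows "no_two_parallel (chords_of_pairs p P) \<longleftrightarrow>
    (\<forall>x y u v. {x, y} \<in> P \<longrightarrow> {u, v} \<in> P \<longrightarrow> {x, y} \<noteq> {u, v} \<longrightarrow>
      \<not> int n dvd (x + y) - (u + v))" (is "_ \<longleftrightarrow> ?R")
proof -
  have par: "affine_parallel (affine hull (closed_segment (p x) (p y)))
      (affine hull (closed_segment (p u) (p v))) \<longleftrightarrow> int n dvd (x + y) - (u + v)"
    if "{x, y} \<in> P" "{u, v} \<in> P" for x y u v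
    using affine_parallel_chords_iff[OF assms(1,2)] unordered_pairsD[OF assms(3)] that by simp
  have "no_two_parallel (chords_of_pairs p P) \<longleftrightarrow>
    (\<forall>x y u v. {x, y} \<in> P \<longrightarrow> {u, v} \<in> P \<longrightarrow>
      closed_segment (p x) (p y) \<noteq> closed_segment (p u) (p v) \<longrightarrow>
      \<not> affine_parallel (affine hull (closed_segment (p x) (p y)))
        (affine hull (closed_segment (p u) (p v))))"
    unfolding no_two_parallel_def chords_of_pairs_def by blast
  also have "\<dots> \<longleftrightarrow> ?R"
    using par closed_segment_eq_chord_iff[OF assms] by (metis (no_types, lifting))
  finally show ?thesis .
qed

lemma no_two_share_endpoint_iff:
  assumes "n > 0" "equally_spaced_on_circle n p" "P \<subseteq> unordered_pairs n"
  shows "no_two_share_endpoint (chords_of_pairs p P) \<longleftrightarrow> disjoint P"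
proof -
  have int: "{p x, p y} \<inter> {p u, p v} = {} \<longleftrightarrow> {x, y} \<inter> {u, v} = {}"
    if "{x, y} \<in> P" "{u, v} \<in> P" for x y u v
    using inj_on_eq_iff[OF inj_on_equally_spaced[OF assms(1,2)]] unordered_pairsD[OF assms(3)] that
    by auto
  have doubleton: "\<exists>x y. e = {x, y}" if "e \<in> P" for e
    using unordered_pairs_doubleton[OF assms(3) that] by metis
  have "no_two_share_endpoint (chords_of_pairs p P) \<longleftrightarrow>
    (\<forall>x y u v. {x, y} \<in> P \<longrightarrow> {u, v} \<in> P \<longrightarrow> {x, y} \<noteq> {u, v} \<longrightarrow>
      {p x, p y} \<inter> {p u, p v} = {})"
    unfolding no_two_share_endpoint_def all_two_chords_iff
    using closed_segment_eq_chord_iff[OF assms] by (metis (no_types, lifting))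
  also have "\<dots> \<longleftrightarrow> (\<forall>x y u v. {x, y} \<in> P \<longrightarrow> {u, v} \<in> P \<longrightarrow> {x, y} \<noteq> {u, v} \<longrightarrow>
      {x, y} \<inter> {u, v} = {})"
    using int by (metis (no_types, lifting))
  also have "\<dots> \<longleftrightarrow> disjoint P"
    unfolding disjoint_def using doubleton by (metis (no_types, lifting))
  finally show ?thesis .
qed

lemma no_bisector_through_zero_iff:
  assumes "n > 0" "equally_spaced_on_circle n p" "P \<subseteq> unordered_pairs n"
  shows "no_bisector_through (p 0) (chords_of_pairs p P) \<longleftrightarrow>
    (\<forall>x y. {x, y} \<in> P \<longrightarrow> \<not> int n dvd x + y)"
  unfolding no_bisector_through_def closed_segment_in_chords_iff
  using zero_mem_bisector_iff[OF assms(1,2)] unordered_pairsD[OF assms(3)] by blast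

lemma not_an_endpoint_zero_iff:
  assumes "n > 0" "equally_spaced_on_circle n p" "P \<subseteq> unordered_pairs n"
  shows "not_an_endpoint (p 0) (chords_of_pairs p P) \<longleftrightarrow> 0 \<notin> \<Union>P"
proof -
  have "\<exists>x y. e = {x, y}" if "e \<in> P" for e
    using unordered_pairs_doubleton[OF assms(3) that] by metis
  then have "0 \<notin> \<Union>P \<longleftrightarrow> (\<forall>x y. {x, y} \<in> P \<longrightarrow> 0 \<notin> {x, y})"
    by (metis Union_iff)
  moreover have "p 0 \<in> {p x, p y} \<longleftrightarrow> 0 \<in> {x, y}" if "{x, y} \<in> P" for x y
    using inj_on_eq_iff[OF inj_on_equally_spaced[OF assms(1,2)]] unordered_pairsD[OF assms(3) that]
    by auto
  ultimately show ?thesis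
    unfolding not_an_endpoint_def closed_segment_in_chords_iff by blast
qed

section \<open>Strong starters by counting\<close>

text \<open>The equality case of the union bound. It is the counting principle behind the covering
  condition on differences.\<close>

lemma card_UN_eq_sum_iff:
  assumes "finite I" "\<And>i. i \<in> I \<Longrightarrow> finite (A i)"
  shows "card (\<Union>i\<in>I. A i) = (\<Sum>i\<in>I. card (A i)) \<longleftrightarrow> disjoint_family_on A I"
  using assms
proof (induction I)
  case empty
  then show ?case by (simp add: disjoint_family_on_def)
next
  case (insert i I)
  let ?U = "\<Union>i\<in>I. A i"
  have "card (A i) + card ?U = card (A i \<union> ?U) + card (A i \<inter> ?U)"
    using insert by (intro card_Un_Int) auto
  moreover have "card ?U \<le> (\<Sum>i\<in>I. card (A i))"
    using insert by (intro card_UN_le)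
  moreover have "card (A i \<inter> ?U) = 0 \<longleftrightarrow> A i \<inter> ?U = {}"
    using insert by (intro card_0_eq) auto
  \<comment> \<open>The total deficit is the size of the new overlap plus the deficit of the smaller
    family. Both are nonnegative, so the total vanishes iff both do.\<close>
  ultimately have "card (\<Union>j\<in>insert i I. A j) = (\<Sum>j\<in>insert i I. card (A j)) \<longleftrightarrow>
      A i \<inter> ?U = {} \<and> card ?U = (\<Sum>i\<in>I. card (A i))"
    using insert.hyps by auto
  also have "\<dots> \<longleftrightarrow> disjoint_family_on A (insert i I)"
    using insert by (simp add: disjoint_family_on_insert)
  finally show ?case .
qed

lemma order_integer_mod_group: "n > 0 \<Longrightarrow> order (integer_mod_group n) = n"
  by (simp add: order_def carrier_integer_mod_group)

lemma mult_inv_integer_mod_group: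
  assumes "t \<in> carrier (integer_mod_group n)"
  shows "s \<otimes>\<^bsub>integer_mod_group n\<^esub> inv\<^bsub>integer_mod_group n\<^esub> t = (s - t) mod int n"
  using assms by (simp add: mod_add_right_eq)

text \<open>Disjoint pairs avoiding zero cover 2 * ((n - 1) div 2) non-zero labels, which for odd
  \<open>n\<close> is all n - 1 of them.\<close>

lemma partition_on_pairs_iff:
  assumes "n > 0" "odd n" "S \<subseteq> unordered_pairs n" "card S = (n - 1) div 2"
  shows "partition_on (carrier (integer_mod_group n) - {0}) S \<longleftrightarrow> disjoint S \<and> 0 \<notin> \<Union>S"
proof -
  have sub: "\<Union>S \<subseteq> carrier (integer_mod_group n)" and card2: "\<And>e. e \<in> S \<Longrightarrow> card e = 2"
    using assms(3) by (auto simp: unordered_pairs_def)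
  then have "{} \<notin> S" "\<And>e. e \<in> S \<Longrightarrow> finite e"
    by (force, metis card.infinite zero_neq_numeral)
  moreover have "\<Union>S = carrier (integer_mod_group n) - {0}" if "disjoint S" "0 \<notin> \<Union>S"
  proof (rule card_subset_eq)
    show "finite (carrier (integer_mod_group n) - {0})"
      using assms(1) by (simp add: carrier_integer_mod_group)
    show "\<Union>S \<subseteq> carrier (integer_mod_group n) - {0}"
      using sub that by blast
    have "card (\<Union>S) = 2 * card S"
      using card_Union_disjoint[OF that(1)] calculation(2) card2 by simp
    also have "\<dots> = card (carrier (integer_mod_group n) - {0})"
      using assms(1,2,4) by (simp add: carrier_integer_mod_group)
    finally show "card (\<Union>S) = card (carrier (integer_mod_group n) - {0})" .
  qed
  ultimately show ?thesis
    unfolding partition_on_def by blast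
qed

text \<open>Each pair contributes exactly two non-zero residues, and the pairs together have room
  for n - 1. Hence these residues exhaust the non-zero elements iff different pairs contribute
  disjoint sets.\<close>

lemma differences_cover_iff:
  assumes "n > 0" "odd n" "S \<subseteq> unordered_pairs n" "card S = (n - 1) div 2"
  shows "{s \<otimes>\<^bsub>integer_mod_group n\<^esub> inv\<^bsub>integer_mod_group n\<^esub> t | s t. {s, t} \<in> S} =
      carrier (integer_mod_group n) - {0} \<longleftrightarrow>
    (\<forall>x y u v. {x, y} \<in> S \<longrightarrow> {u, v} \<in> S \<longrightarrow> {x, y} \<noteq> {u, v} \<longrightarrow>
      \<not> int n dvd (x - y) - (u - v))" (is "?D = ?N \<longleftrightarrow> ?R")
proof -
  define D where "D e = {(s - t) mod int n | s t. {s, t} = e}" for e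
  have fin: "finite ?N" "card ?N = 2 * card S"
    using assms(1,2,4) by (simp_all add: carrier_integer_mod_group)
  have "finite (unordered_pairs n)"
    by (rule finite_subset[of _ "Pow (carrier (integer_mod_group n))"])
      (use assms(1) in \<open>auto simp: unordered_pairs_def carrier_integer_mod_group\<close>)
  then have finS: "finite S"
    using assms(3) finite_subset by blast
  have nd: "\<not> int n dvd s - t" if "{s, t} \<in> S" for s t
    using unordered_pairsD[OF assms(3) that] dvd_diff_carrier_imp_eq[OF assms(1)] by blast
  have D_pair: "D {s, t} = {(s - t) mod int n, (t - s) mod int n}" for s t
    unfolding D_def doubleton_eq_iff by blast
  have D: "card (D e) = 2" "D e \<subseteq> ?N" if "e \<in> S" for e
  proof -
    obtain s t where e: "e = {s, t}"
      using unordered_pairs_doubleton[OF assms(3) \<open>e \<in> S\<close>] by metis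
    have st: "\<not> int n dvd s - t" "\<not> int n dvd t - s"
      using nd[of s t] nd[of t s] \<open>e \<in> S\<close> by (auto simp: e insert_commute)
    \<comment> \<open>The two differences of a pair are distinct because 2 is invertible modulo the
      odd number \<open>n\<close>.\<close>
    have "(s - t) - (t - s) = 2 * (s - t)"
      by simp
    moreover have "coprime (int n) 2"
      using assms(2) by (simp add: coprime_right_2_iff_odd)
    ultimately have "\<not> int n dvd (s - t) - (t - s)"
      using st by (metis coprime_dvd_mult_right_iff)
    then show "card (D e) = 2"
      unfolding e D_pair by (simp add: mod_eq_dvd_iff)
    show "D e \<subseteq> ?N"
      using st assms(1) by (auto simp: e D_pair carrier_integer_mod_group dvd_eq_mod_eq_0)
  qed
  have "?D = {(s - t) mod int n | s t. {s, t} \<in> S}"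
    using mult_inv_integer_mod_group unordered_pairsD(2)[OF assms(3)]
    by (intro Collect_cong) metis
  also have "\<dots> = (\<Union>e\<in>S. D e)"
    unfolding D_def by blast
  finally have "?D = (\<Union>e\<in>S. D e)" .
  \<comment> \<open>The union lies in the finite set \<open>?N\<close>, so equality can be tested on
    cardinalities.\<close>
  moreover have "(\<Union>e\<in>S. D e) = ?N \<longleftrightarrow> card (\<Union>e\<in>S. D e) = card ?N"
    using D fin by (metis UN_least card_subset_eq)
  moreover have "card ?N = (\<Sum>e\<in>S. card (D e))"
    using D fin by simp
  moreover have "finite (D e)" if "e \<in> S" for e
    using D(2)[OF that] fin finite_subset by blast
  ultimately have "?D = ?N \<longleftrightarrow> disjoint_family_on D S"
    using card_UN_eq_sum_iff[OF finS] by metis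
  also have "\<dots> \<longleftrightarrow> (\<forall>x y u v. {x, y} \<in> S \<longrightarrow> {u, v} \<in> S \<longrightarrow> {x, y} \<noteq> {u, v} \<longrightarrow>
      (x - y) mod int n \<noteq> (u - v) mod int n)"
  proof (intro iffI allI impI)
    fix x y u v
    assume "disjoint_family_on D S" "{x, y} \<in> S" "{u, v} \<in> S" "{x, y} \<noteq> {u, v}"
    then have "D {x, y} \<inter> D {u, v} = {}"
      by (simp add: disjoint_family_on_def)
    then show "(x - y) mod int n \<noteq> (u - v) mod int n"
      unfolding D_pair by auto
  next
    assume *: "\<forall>x y u v. {x, y} \<in> S \<longrightarrow> {u, v} \<in> S \<longrightarrow> {x, y} \<noteq> {u, v} \<longrightarrow>
      (x - y) mod int n \<noteq> (u - v) mod int n"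
    show "disjoint_family_on D S"
      unfolding disjoint_family_on_def
    proof (intro ballI impI equals0I)
      fix e e' k assume e: "e \<in> S" "e' \<in> S" "e \<noteq> e'" and "k \<in> D e \<inter> D e'"
      \<comment> \<open>A common residue fixes an order in each pair; since \<open>*\<close> covers
        all orders, no case distinction on signs arises.\<close>
      then obtain x y u v where "e = {x, y}" "e' = {u, v}" "k = (x - y) mod int n"
          "k = (u - v) mod int n"
        unfolding D_def by blast
      then show False
        using * e by metis
    qed
  qed
  finally show ?thesis
    by (simp add: mod_eq_dvd_iff)
qed

section \<open>Strong starters and chord properties are equivalent\<close>

text \<open>Given the right number of pairs, the partition and covering conditions become
  disjointness conditions. The conjuncts after the cardinality follow the order (a) to (e), so that
  they match the chord criteria term by term.\<close>

lemma strong_starter_integer_mod_group_iff: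
  assumes "n > 0" "odd n"
  shows "strong_starter (integer_mod_group n) S \<longleftrightarrow>
    S \<subseteq> unordered_pairs n \<and> card S = (n - 1) div 2 \<and>
    (\<forall>x y u v. {x, y} \<in> S \<longrightarrow> {u, v} \<in> S \<longrightarrow> {x, y} \<noteq> {u, v} \<longrightarrow>
      \<not> int n dvd (x - y) - (u - v)) \<and>
    (\<forall>x y u v. {x, y} \<in> S \<longrightarrow> {u, v} \<in> S \<longrightarrow> {x, y} \<noteq> {u, v} \<longrightarrow>
      \<not> int n dvd (x + y) - (u + v)) \<and>
    disjoint S \<and>
    (\<forall>x y. {x, y} \<in> S \<longrightarrow> \<not> int n dvd x + y) \<and>
    0 \<notin> \<Union>S"
proof (cases "S \<subseteq> unordered_pairs n \<and> card S = (n - 1) div 2")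
  case True
  then have "\<forall>e\<in>S. card e = 2"
    by (auto simp: unordered_pairs_def)
  then show ?thesis
    using True partition_on_pairs_iff[OF assms] differences_cover_iff[OF assms]
    unfolding strong_starter_def starter_def
    by (simp add: order_integer_mod_group assms(1) mod_eq_dvd_iff dvd_eq_mod_eq_0[symmetric] conj_ac)
next
  case False
  \<comment> \<open>A partition of the non-zero elements into two-element blocks consists of pairs
    of labels, so outside the first case both sides fail.\<close>
  moreover have "S \<subseteq> unordered_pairs n \<and> card S = (n - 1) div 2"
    if "strong_starter (integer_mod_group n) S"
    using that order_integer_mod_group[OF assms(1)]
    unfolding strong_starter_def starter_def partition_on_def unordered_pairs_def by auto
  ultimately show ?thesis
    by blast
qed

lemma strong_starter_iff_chords:
  assumes "n > 0" "odd n" "equally_spaced_on_circle n p"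
  shows "strong_starter (integer_mod_group n) S \<longleftrightarrow>
    S \<subseteq> unordered_pairs n \<and>
    card (chords_of_pairs p S) = (n - 1) div 2 \<and>
    no_two_same_length (chords_of_pairs p S) \<and>
    no_two_parallel (chords_of_pairs p S) \<and>
    no_two_share_endpoint (chords_of_pairs p S) \<and>
    no_bisector_through (p 0) (chords_of_pairs p S) \<and>
    not_an_endpoint (p 0) (chords_of_pairs p S)"
proof (cases "S \<subseteq> unordered_pairs n")
  case True
  note iffs = card_chords_of_pairs no_two_same_length_iff no_two_parallel_iff
    no_two_share_endpoint_iff no_bisector_through_zero_iff not_an_endpoint_zero_iff
  show ?thesis
    unfolding strong_starter_integer_mod_group_iff[OF assms(1,2)]
      iffs[OF assms(1,3) True] by (rule refl)
next
  case False
  then show ?thesis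
    unfolding strong_starter_integer_mod_group_iff[OF assms(1,2)] by (simp only: simp_thms)
qed

theorem theorem2:
  fixes n :: nat and p :: "int \<Rightarrow> complex"
  assumes "n \<ge> 3" and "odd n"
    and "equally_spaced_on_circle n p"
  shows "(\<forall>S. strong_starter (integer_mod_group n) S \<longrightarrow>
            chords_of_pairs p S \<subseteq> chords_of_pairs p (unordered_pairs n) \<and>
            card (chords_of_pairs p S) = (n - 1) div 2 \<and>
            no_two_same_length (chords_of_pairs p S) \<and>
            no_two_parallel (chords_of_pairs p S) \<and>
            no_two_share_endpoint (chords_of_pairs p S) \<and>
            no_bisector_through (p 0) (chords_of_pairs p S) \<and>
            not_an_endpoint (p 0) (chords_of_pairs p S)) \<and>
         (\<forall>C. C \<subseteq> chords_of_pairs p (unordered_pairs n) \<and>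
            card C = (n - 1) div 2 \<and>
            no_two_same_length C \<and>
            no_two_parallel C \<and>
            no_two_share_endpoint C \<and>
            no_bisector_through (p 0) C \<and>
            not_an_endpoint (p 0) C \<longrightarrow>
            strong_starter (integer_mod_group n) (pairs_of_chords n p C))"
proof (intro conjI allI impI)
  have "n > 0"
    using assms(1) by simp
  note iff = strong_starter_iff_chords[OF this assms(2,3)]
  fix S assume S: "strong_starter (integer_mod_group n) S"
  then have "S \<subseteq> unordered_pairs n"
    unfolding iff by (rule conjunct1)
  then show "chords_of_pairs p S \<subseteq> chords_of_pairs p (unordered_pairs n)"
    unfolding chords_of_pairs_def by blast
  show "card (chords_of_pairs p S) = (n - 1) div 2"
    "no_two_same_length (chords_of_pairs p S)" "no_two_parallel (chords_of_pairs p S)"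
    "no_two_share_endpoint (chords_of_pairs p S)"
    "no_bisector_through (p 0) (chords_of_pairs p S)"
    "not_an_endpoint (p 0) (chords_of_pairs p S)"
    using S unfolding iff by simp_all
next
  have "n > 0"
    using assms(1) by simp
  note iff = strong_starter_iff_chords[OF this assms(2,3)]
  fix C assume C: "C \<subseteq> chords_of_pairs p (unordered_pairs n) \<and> card C = (n - 1) div 2 \<and>
    no_two_same_length C \<and> no_two_parallel C \<and> no_two_share_endpoint C \<and>
    no_bisector_through (p 0) C \<and> not_an_endpoint (p 0) C"
  have "pairs_of_chords n p C \<subseteq> unordered_pairs n"
    unfolding pairs_of_chords_def by blast
  \<comment> \<open>The round trip turns the assumptions on \<open>C\<close> into the right-hand
    side of the equivalence for \<open>pairs_of_chords n p C\<close>.\<close>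
  moreover have "chords_of_pairs p (pairs_of_chords n p C) = C"
    using C chords_of_pairs_of_chords by blast
  ultimately show "strong_starter (integer_mod_group n) (pairs_of_chords n p C)"
    unfolding iff using C by simp
qed

end
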